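(* The 4-regular planar multigraph $M$ on 12 vertices (defined in the context) is not circle representable.
   Context: **Circle representations.** A *circle representation* of a 4-regular planar (multi)graph $G$ is a collection of circles embedded in $\mathbb{R}^2$ such that each point of the plane belongs to at most two circles, the set of points belonging to exactly two circles is in bijective correspondence with the vertex set of $G$, and the circular arcs between those points (the arcs into which these points divide the circles) correspond to the edge (multi)set of $G$, an arc corresponding to an edge joining the vertices represented by the endpoints of the arc. A point in the intersection of two circles is a *touching* point if it is the only point at which those circles intersect, and a *crossing* point if it is one of the two points at which they intersect. A graph is *circle representable* if it admits a circle representation. **The multigraph $M$.** $M$ consists of an 8-cycle $v_1v_2\cdots v_8v_1$ together with four pairs of neighbouring digons (pairs of parallel edges) attached at each of $(v_1,v_4)$, $(v_2,v_7)$, $(v_3,v_6)$ and $(v_5,v_8)$. Explicitly, $M$ has vertices $v_1,\dots,v_8,a,b,c,d$; its edges are the edges of the 8-cycle $v_1v_2\cdots v_8v_1$ (each with multiplicity one), together with the following edges, each with multiplicity two: $av_1, av_4$; $bv_2, bv_7$; $cv_3, cv_6$; $dv_5, dv_8$. *)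

theory Defs
  imports "HOL-Analysis.Analysis" "HOL-Library.Multiset" "HOL-Library.Uprod"
begin

text \<open>Undirected multigraphs; the loop at \<open>v\<close> is \<open>Upair v v\<close>.\<close>

record 'v multigraph =
  verts :: "'v set"
  edges :: "'v uprod multiset"

text \<open>The edges as distinct individuals: parallel edges are told apart by an index.\<close>

definition edge_copies :: "'v multigraph \<Rightarrow> ('v uprod \<times> nat) set" where
  "edge_copies G = {(e, k). k < count (edges G) e}"

definition degree :: "'v multigraph \<Rightarrow> 'v \<Rightarrow> nat" where
  "degree G v = size {#e \<in># edges G. v \<in> set_uprod e#} + count (edges G) (Upair v v)"

definition is_circle :: "(real^2) set \<Rightarrow> bool" where
  "is_circle C \<longleftrightarrow> (\<exists>z r. r > 0 \<and> C = sphere z r)"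

definition circles_through :: "(real^2) set set \<Rightarrow> real^2 \<Rightarrow> (real^2) set set" where
  "circles_through \<C> p = {C \<in> \<C>. p \<in> C}"

definition double_points :: "(real^2) set set \<Rightarrow> (real^2) set" where
  "double_points \<C> = {p. card (circles_through \<C> p) = 2}"

text \<open>
  The arcs are taken without their endpoints. A circle that meets no other circle of the
  collection is not divided into arcs between double points, so it contributes none.
\<close>

definition circle_arcs :: "(real^2) set set \<Rightarrow> (real^2) set set" where
  "circle_arcs \<C> =
    (\<Union>C \<in> {C \<in> \<C>. C \<inter> double_points \<C> \<noteq> {}}. components (C - double_points \<C>))"

text \<open>
  This has two elements in general, and one if the arc is a circle with a single point removed
  (a loop).
\<close>

definition arc_ends :: "(real^2) set \<Rightarrow> (real^2) set" where
  "arc_ends A = closure A - A"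

text \<open>
  The finiteness requirement is not redundant, since \<^const>\<open>card\<close> is \<open>0\<close> on infinite sets.
\<close>

definition circle_representation :: "(real^2) set set \<Rightarrow> 'v multigraph \<Rightarrow> bool" where
  "circle_representation \<C> G \<longleftrightarrow>
    (\<forall>C \<in> \<C>. is_circle C) \<and>
    (\<forall>p. finite (circles_through \<C> p) \<and> card (circles_through \<C> p) \<le> 2) \<and>
    (\<exists>\<phi> \<psi>.
      bij_betw \<phi> (double_points \<C>) (verts G) \<and>
      bij_betw \<psi> (circle_arcs \<C>) (edge_copies G) \<and>
      (\<forall>A \<in> circle_arcs \<C>. set_uprod (fst (\<psi> A)) = \<phi> ` arc_ends A))"

definition circle_representable :: "'v multigraph \<Rightarrow> bool" where
  "circle_representable G \<longleftrightarrow> (\<exists>\<C>. circle_representation \<C> G)"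

datatype M_vertex = V1 | V2 | V3 | V4 | V5 | V6 | V7 | V8 | VA | VB | VC | VD

definition M :: "M_vertex multigraph" where
  "M = \<lparr> verts = {V1, V2, V3, V4, V5, V6, V7, V8, VA, VB, VC, VD},
         edges =
           {# Upair V1 V2, Upair V2 V3, Upair V3 V4, Upair V4 V5,
              Upair V5 V6, Upair V6 V7, Upair V7 V8, Upair V8 V1 #} +
           repeat_mset 2
           {# Upair VA V1, Upair VA V4, Upair VB V2, Upair VB V7,
              Upair VC V3, Upair VC V6, Upair VD V5, Upair VD V8 #} \<rparr>"

lemma card_verts_M: "card (verts M) = 12"
  by (simp add: M_def)

lemma M_four_regular: "v \<in> verts M \<Longrightarrow> degree M v = 4"
  by (cases v) (simp_all add: M_def degree_def numeral_2_eq_2)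

end

theory Submission
  imports Defs
begin

text \<open>
  At the vertex \<open>a\<close> of \<open>M\<close> two circles cannot both run from \<open>v\<^sub>1\<close> through \<open>a\<close> to \<open>v\<^sub>4\<close>, as they
  would share three points; hence each digon at \<open>a\<close> is a full circle, and likewise at \<open>b\<close>, \<open>c\<close>, \<open>d\<close>.
  The remaining arcs then run straight through every \<open>v\<^sub>i\<close>, so the 8-cycle is a single circle \<open>E\<close>,
  and there are circles \<open>C\<^sub>i\<close> touching \<open>E\<close> at \<open>v\<^sub>i\<close> such that \<open>C\<^sub>i\<close> and \<open>C\<^sub>j\<close> meet exactly for the
  pairs \<open>14\<close>, \<open>27\<close>, \<open>36\<close>, \<open>58\<close>. Two circles touching \<open>E\<close> meet iff \<open>sin\<^sup>2\<close> of half the angle between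
  their points of contact is at most \<open>k\<^sub>i k\<^sub>j\<close>, where the parameter \<open>k\<^sub>i\<close> is determined by the signed
  radius of \<open>C\<^sub>i\<close>. Ptolemy's identity then puts pairs with crossing chords on different sides of \<open>E\<close>;
  so \<open>C\<^sub>1, C\<^sub>4, C\<^sub>5, C\<^sub>8\<close> lie on one side and \<open>C\<^sub>2, C\<^sub>7, C\<^sub>3, C\<^sub>6\<close> on the other. On each side the inequalities
  bound a cross ratio of four points of contact, and since \<open>v\<^sub>2, v\<^sub>3\<close> lie between \<open>v\<^sub>1\<close> and \<open>v\<^sub>4\<close> and
  \<open>v\<^sub>6, v\<^sub>7\<close> between \<open>v\<^sub>5\<close> and \<open>v\<^sub>8\<close>, the two bounds are incompatible.
\<close>

section \<open>Chords of a circle\<close>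

lemma Ptolemy_sin:
  fixes w x y z :: real
  shows "sin (y - w) * sin (z - x) = sin (x - w) * sin (z - y) + sin (z - w) * sin (y - x)"
  by (simp add: sin_diff algebra_simps)

lemma sin_Ptolemy_less:
  fixes w x y z :: real
  assumes "w < x" "x < y" "y < z" "z < w + pi"
  shows "sin (x - w) * sin (z - y) < sin (y - w) * sin (z - x)"
    and "sin (z - w) * sin (y - x) < sin (y - w) * sin (z - x)"
proof -
  have "sin (x - w) > 0" "sin (z - y) > 0" "sin (z - w) > 0" "sin (y - x) > 0"
    using assms by (auto intro!: sin_gt_zero)
  then show "sin (x - w) * sin (z - y) < sin (y - w) * sin (z - x)"
    and "sin (z - w) * sin (y - x) < sin (y - w) * sin (z - x)"
    unfolding Ptolemy_sin[of y w z x] by simp_all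
qed

lemma crossing_chords_opposite_sides:
  fixes w x y z :: real
  assumes ord: "w < x" "x < y" "y < z" "z < w + pi"
    and "sin (y - w) ^ 2 \<le> kw * ky" "sin (z - x) ^ 2 \<le> kx * kz"
    and "sin (x - w) ^ 2 > kw * kx" "sin (z - y) ^ 2 > ky * kz"
  shows "kw * kx < 0"
proof (rule ccontr)
  assume "\<not> kw * kx < 0"
  moreover have pos: "sin (y - w) > 0" "sin (z - x) > 0" "sin (x - w) > 0" "sin (z - y) > 0"
    using ord by (auto intro!: sin_gt_zero)
  then have "kw * ky > 0" "kx * kz > 0"
    using assms(5,6) by (smt (verit) zero_less_power)+
  ultimately have "kw * kx > 0" "ky * kz > 0"
    by (auto simp: zero_less_mult_iff mult_less_0_iff not_less)
  have "(sin (y - w) * sin (z - x)) ^ 2 \<le> (kw * ky) * (kx * kz)"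
    unfolding power_mult_distrib using assms(5,6) by (intro mult_mono) (use \<open>kw * ky > 0\<close> in auto)
  also have "\<dots> = (kw * kx) * (ky * kz)" by simp
  also have "\<dots> \<le> (sin (x - w) * sin (z - y)) ^ 2"
    unfolding power_mult_distrib using assms(7,8) \<open>kw * kx > 0\<close> \<open>ky * kz > 0\<close>
    by (intro mult_mono) auto
  finally have "sin (y - w) * sin (z - x) \<le> sin (x - w) * sin (z - y)"
    by (rule power2_le_imp_le) (use pos in simp)
  then show False using sin_Ptolemy_less(1)[OF ord] by simp
qed

lemma sin_cross_ratio_mono:
  fixes x1 x2 x3 x4 x5 x6 x7 x8 :: real
  assumes ord: "x1 < x2" "x2 < x3" "x3 < x4" "x4 < x5" "x5 < x6" "x6 < x7" "x7 < x8" "x8 < x1 + pi"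
  shows "sin (x3 - x2) * sin (x7 - x6) * (sin (x8 - x1) * sin (x5 - x4))
       < sin (x7 - x2) * sin (x6 - x3) * (sin (x4 - x1) * sin (x8 - x5))"
proof -
  note P = sin_Ptolemy_less
  let ?s = "\<lambda>x y. sin (y - x)"
  have pos: "?s x2 x3 > 0" "?s x6 x7 > 0" "?s x1 x8 > 0" "?s x4 x5 > 0" "?s x2 x7 > 0"
    "?s x3 x6 > 0" "?s x1 x4 > 0" "?s x5 x8 > 0" "?s x1 x7 > 0" "?s x1 x3 > 0" "?s x4 x6 > 0" "?s x5 x7 > 0"
    using ord by (auto intro!: sin_gt_zero)
  have 1: "?s x2 x3 * ?s x1 x7 < ?s x1 x3 * ?s x2 x7"
    using P(2)[of x1 x2 x3 x7] ord by (simp add: mult.commute)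
  have 2: "?s x1 x3 * ?s x4 x6 < ?s x1 x4 * ?s x3 x6"
    using P(1)[of x1 x3 x4 x6] ord by (simp add: mult.commute)
  have 3: "?s x6 x7 * ?s x4 x5 < ?s x5 x7 * ?s x4 x6"
    using P(1)[of x4 x5 x6 x7] ord by (simp add: mult.commute)
  have 4: "?s x5 x7 * ?s x1 x8 < ?s x5 x8 * ?s x1 x7"
    using P(2)[of x1 x5 x7 x8] ord by (simp add: mult.commute)
  have 5: "(?s x2 x3 * ?s x1 x7) * (?s x1 x3 * ?s x4 x6) < (?s x1 x3 * ?s x2 x7) * (?s x1 x4 * ?s x3 x6)"
    by (rule mult_strict_mono[OF 1 2]) (use pos in auto)
  have 6: "(?s x6 x7 * ?s x4 x5) * (?s x5 x7 * ?s x1 x8) < (?s x5 x7 * ?s x4 x6) * (?s x5 x8 * ?s x1 x7)"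
    by (rule mult_strict_mono[OF 3 4]) (use pos in auto)
  have "((?s x2 x3 * ?s x1 x7) * (?s x1 x3 * ?s x4 x6)) * ((?s x6 x7 * ?s x4 x5) * (?s x5 x7 * ?s x1 x8))
     < ((?s x1 x3 * ?s x2 x7) * (?s x1 x4 * ?s x3 x6)) * ((?s x5 x7 * ?s x4 x6) * (?s x5 x8 * ?s x1 x7))"
    by (rule mult_strict_mono[OF 5 6]) (use pos in auto)
  then have "(?s x1 x7 * ?s x1 x3 * ?s x4 x6 * ?s x5 x7) * (?s x2 x3 * ?s x6 x7 * (?s x1 x8 * ?s x4 x5))
    < (?s x1 x7 * ?s x1 x3 * ?s x4 x6 * ?s x5 x7) * (?s x2 x7 * ?s x3 x6 * (?s x1 x4 * ?s x5 x8))"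
    by (simp only: ac_simps)
  then show ?thesis using pos by (simp add: mult_less_cancel_left_pos)
qed

text \<open>
  The \<open>x\<^sub>i\<close> are half the angles of the points of contact, so that chords are proportional to
  \<open>sin (x\<^sub>j - x\<^sub>i)\<close>; the \<open>k\<^sub>i\<close> are the quotients \<open>s / (R - s)\<close> of \<open>tangent_spheres_meet_iff\<close>.
\<close>

lemma tangent_circle_pattern_impossible:
  fixes x1 x2 x3 x4 x5 x6 x7 x8 k1 k2 k3 k4 k5 k6 k7 k8 :: real
  assumes ord: "x1 < x2" "x2 < x3" "x3 < x4" "x4 < x5" "x5 < x6" "x6 < x7" "x7 < x8" "x8 < x1 + pi"
    and "sin (x4 - x1) ^ 2 \<le> k1 * k4" "sin (x7 - x2) ^ 2 \<le> k2 * k7"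
    and "sin (x6 - x3) ^ 2 \<le> k3 * k6" "sin (x8 - x5) ^ 2 \<le> k5 * k8"
    and "sin (x2 - x1) ^ 2 > k1 * k2" "sin (x7 - x4) ^ 2 > k4 * k7"
    and "sin (x3 - x1) ^ 2 > k1 * k3" "sin (x6 - x4) ^ 2 > k4 * k6"
    and "sin (x5 - x2) ^ 2 > k2 * k5" "sin (x8 - x7) ^ 2 > k7 * k8"
    and "sin (x8 - x1) ^ 2 > k1 * k8" "sin (x5 - x4) ^ 2 > k4 * k5"
    and "sin (x3 - x2) ^ 2 > k2 * k3" "sin (x7 - x6) ^ 2 > k6 * k7"
  shows False
proof -
  have pos: "sin (x4 - x1) > 0" "sin (x7 - x2) > 0" "sin (x6 - x3) > 0" "sin (x8 - x5) > 0"
    "sin (x8 - x1) > 0" "sin (x5 - x4) > 0" "sin (x3 - x2) > 0" "sin (x7 - x6) > 0"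
    using ord by (auto intro!: sin_gt_zero)
  have k: "k1 * k4 > 0" "k2 * k7 > 0" "k3 * k6 > 0" "k5 * k8 > 0"
    using assms(9-12) pos by (smt (verit) zero_less_power)+
  have "k1 * k2 < 0"
    by (rule crossing_chords_opposite_sides[of x1 x2 x4 x7]) (use assms in auto)
  moreover have "k1 * k3 < 0"
    by (rule crossing_chords_opposite_sides[of x1 x3 x4 x6]) (use assms in auto)
  moreover have "k2 * k5 < 0"
    by (rule crossing_chords_opposite_sides[of x2 x5 x7 x8]) (use assms in auto)
  ultimately have k': "k1 * k8 > 0" "k4 * k5 > 0" "k2 * k3 > 0" "k6 * k7 > 0"
    using k by (auto simp: zero_less_mult_iff mult_less_0_iff)
  have "(sin (x4 - x1) * sin (x8 - x5)) ^ 2 \<le> (k1 * k4) * (k5 * k8)"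
    unfolding power_mult_distrib using assms k by (intro mult_mono) auto
  also have "\<dots> = (k1 * k8) * (k4 * k5)" by simp
  also have "\<dots> \<le> (sin (x8 - x1) * sin (x5 - x4)) ^ 2"
    unfolding power_mult_distrib using assms k' by (intro mult_mono) auto
  finally have 1: "sin (x4 - x1) * sin (x8 - x5) \<le> sin (x8 - x1) * sin (x5 - x4)"
    by (rule power2_le_imp_le) (use pos in simp)
  have "(sin (x7 - x2) * sin (x6 - x3)) ^ 2 \<le> (k2 * k7) * (k3 * k6)"
    unfolding power_mult_distrib using assms k by (intro mult_mono) auto
  also have "\<dots> = (k2 * k3) * (k6 * k7)" by simp
  also have "\<dots> \<le> (sin (x3 - x2) * sin (x7 - x6)) ^ 2"
    unfolding power_mult_distrib using assms k' by (intro mult_mono) auto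
  finally have 2: "sin (x7 - x2) * sin (x6 - x3) \<le> sin (x3 - x2) * sin (x7 - x6)"
    by (rule power2_le_imp_le) (use pos in simp)
  have "sin (x7 - x2) * sin (x6 - x3) * (sin (x4 - x1) * sin (x8 - x5))
    \<le> sin (x3 - x2) * sin (x7 - x6) * (sin (x8 - x1) * sin (x5 - x4))"
    by (rule mult_mono[OF 2 1]) (use pos in auto)
  then show False using sin_cross_ratio_mono[OF ord] by simp
qed

section \<open>Tangent circles\<close>

lemma spheres_three_common_points:
  fixes z w a b c :: "real^2"
  assumes "{a, b, c} \<subseteq> sphere z r \<inter> sphere w q" "a \<noteq> b" "a \<noteq> c" "b \<noteq> c"
  shows "sphere z r = sphere w q"
proof -
  have e: "(x - z) \<bullet> (x - z) = r^2" "(x - w) \<bullet> (x - w) = q^2" if "x \<in> {a,b,c}" for x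
    using assms(1) that by (auto simp: dist_norm norm_minus_commute simp flip: power2_norm_eq_inner)
  have "z = w"
  proof (rule ccontr)
    assume "z \<noteq> w"
    define m where "m = (vector [z$2 - w$2, w$1 - z$1] :: real^2)"
    have m: "m$1 = z$2 - w$2" "m$2 = w$1 - z$1" by (simp_all add: m_def)
    have mm: "m \<bullet> m \<noteq> 0"
      using \<open>z \<noteq> w\<close> by (auto simp: m vec_eq_iff forall_2)
    have par: "\<exists>t. y - a = t *\<^sub>R m" if "y \<in> {b, c}" for y
    proof -
      have y: "(y - a) \<bullet> (z - w) = 0"
        using e[of y] e[of a] that by (auto simp: inner_vec_def sum_2 algebra_simps)
      have "y - a = (((y - a) \<bullet> m) / (m \<bullet> m)) *\<^sub>R m"
      proof -
        have "(m \<bullet> m) *\<^sub>R (y - a) = ((y - a) \<bullet> m) *\<^sub>R m"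
          using y unfolding vec_eq_iff forall_2 inner_vec_def sum_2
          by (simp add: m) algebra
        then show ?thesis using mm
          by (metis divide_inverse_commute divideR_right scaleR_scaleR)
      qed
      then show ?thesis by blast
    qed
    have coeff: "t = - 2 * ((a - z) \<bullet> m) / (m \<bullet> m)" if "y \<in> {b, c}" "y - a = t *\<^sub>R m" for y t
    proof -
      have "y = a + t *\<^sub>R m" using that by (simp add: algebra_simps)
      then have "(y - z) \<bullet> (y - z) = (a - z) \<bullet> (a - z) + t * (2 * ((a - z) \<bullet> m) + t * (m \<bullet> m))"
        by (simp add: inner_vec_def sum_2 algebra_simps)
      then have "t * (2 * ((a - z) \<bullet> m) + t * (m \<bullet> m)) = 0" using e[of y] e[of a] that by auto
      moreover have "t \<noteq> 0" using that assms by auto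
      ultimately have "t * (m \<bullet> m) = - 2 * ((a - z) \<bullet> m)" by simp
      then show ?thesis by (subst nonzero_eq_divide_eq[OF mm])
    qed
    obtain t t' where t: "b - a = t *\<^sub>R m" "c - a = t' *\<^sub>R m" using par by blast
    then have "t = t'" using coeff by blast
    then have "b - a = c - a" using t by simp
    then show False using assms by simp
  qed
  then show ?thesis using assms(1) by auto
qed

text \<open>
  The number \<open>s\<close> is a signed radius: the touching sphere lies outside for \<open>s < 0\<close>, inside for
  \<open>0 < s < R\<close>, and encloses \<open>sphere z R\<close> for \<open>s > R\<close>.
\<close>

lemma tangent_sphere_center:
  fixes z c u :: "'a::euclidean_space"
  assumes "R > 0" "norm u = 1" "sphere c r \<inter> sphere z R = {z + R *\<^sub>R u}" "sphere c r \<noteq> sphere z R"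
  obtains s where "s \<noteq> R" "c = z + (R - s) *\<^sub>R u" "r = \<bar>s\<bar>"
proof -
  have "z + R *\<^sub>R u \<in> sphere c r \<inter> sphere z R" by (subst assms(3)) (rule singletonI)
  then have cr: "dist c (z + R *\<^sub>R u) = r" by simp
  have "c \<noteq> z"
  proof
    assume "c = z"
    then have "r = R" using cr assms(1,2) by (simp add: dist_norm)
    then show False using assms(4) \<open>c = z\<close> by blast
  qed
  define w where "w = sgn (c - z)"
  define h where "h = norm (c - z)"
  have w: "norm w = 1" "c - z = h *\<^sub>R w" and "h \<noteq> 0"
    using \<open>c \<noteq> z\<close> by (simp_all add: w_def h_def norm_sgn sgn_div_norm)
  define u' where "u' = (2 * (u \<bullet> w)) *\<^sub>R w - u"
  have uu: "u \<bullet> u = 1" "w \<bullet> w = 1" using assms w by (simp_all add: dot_square_norm)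
  have u'w: "u' \<bullet> w = u \<bullet> w" "u' \<bullet> u' = 1"
    by (simp_all add: u'_def inner_diff inner_commute uu algebra_simps)
  have "norm u' = 1" using u'w by (simp add: norm_eq_sqrt_inner)
  have "dist c (z + R *\<^sub>R u') ^ 2 = dist c (z + R *\<^sub>R u) ^ 2"
  proof -
    have "dist c (z + R *\<^sub>R v) ^ 2 = h^2 - 2 * R * h * (v \<bullet> w) + R^2 * (v \<bullet> v)" for v
    proof -
      have "c - (z + R *\<^sub>R v) = h *\<^sub>R w - R *\<^sub>R v"
        unfolding w(2)[symmetric] by simp
      then show ?thesis
        unfolding dist_norm power2_norm_eq_inner
        by (simp add: inner_diff inner_commute uu power2_eq_square algebra_simps)
    qed
    then show ?thesis using u'w uu by simp
  qed
  then have "dist c (z + R *\<^sub>R u') = r" using cr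
    by (metis power2_eq_iff_nonneg zero_le_dist)
  then have "z + R *\<^sub>R u' \<in> sphere c r \<inter> sphere z R"
    using \<open>norm u' = 1\<close> assms(1) by (simp add: dist_norm[of z])
  then have "u' = u" unfolding assms(3) using assms(1) by simp
  then have uw: "u = (u \<bullet> w) *\<^sub>R w"
  proof -
    have "2 *\<^sub>R u = 2 *\<^sub>R ((u \<bullet> w) *\<^sub>R w)"
      using \<open>u' = u\<close> unfolding u'_def by (simp add: algebra_simps scaleR_2)
    then show ?thesis by (simp del: scaleR_scaleR)
  qed
  then have "norm u = \<bar>u \<bullet> w\<bar> * norm w" by (metis norm_scaleR)
  then have "(u \<bullet> w) * (u \<bullet> w) = 1"
    using assms(2) w(1) by (metis abs_mult_self_eq mult.right_neutral)
  then have "w = (u \<bullet> w) *\<^sub>R u" using uw by (metis scaleR_one scaleR_scaleR)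
  then have "c - z = (h * (u \<bullet> w)) *\<^sub>R u"
    using w(2) by (metis scaleR_scaleR)
  define s where "s = R - h * (u \<bullet> w)"
  have 1: "c = z + (R - s) *\<^sub>R u"
    using \<open>c - z = (h * (u \<bullet> w)) *\<^sub>R u\<close> by (simp add: s_def algebra_simps)
  moreover have "s \<noteq> R" using \<open>h \<noteq> 0\<close> \<open>(u \<bullet> w) * (u \<bullet> w) = 1\<close> by (auto simp: s_def)
  moreover have "r = \<bar>s\<bar>"
  proof -
    have "c - (z + R *\<^sub>R u) = (- s) *\<^sub>R u" by (subst 1) (simp add: algebra_simps)
    then have "norm (c - (z + R *\<^sub>R u)) = \<bar>s\<bar>" using assms(2) by simp
    then show ?thesis using cr by (simp add: dist_norm)
  qed
  ultimately show ?thesis using that by blast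
qed

lemma spheres_meet_iff:
  fixes c d :: "'a::euclidean_space"
  assumes "DIM('a) \<ge> 2" "r \<ge> 0" "q \<ge> 0"
  shows "sphere c r \<inter> sphere d q \<noteq> {} \<longleftrightarrow> \<bar>r - q\<bar> \<le> dist c d \<and> dist c d \<le> r + q"
proof
  assume "sphere c r \<inter> sphere d q \<noteq> {}"
  then obtain x where "dist c x = r" "dist d x = q" by (metis disjoint_iff mem_sphere)
  then show "\<bar>r - q\<bar> \<le> dist c d \<and> dist c d \<le> r + q"
    by (smt (verit) dist_commute dist_triangle)
next
  assume h: "\<bar>r - q\<bar> \<le> dist c d \<and> dist c d \<le> r + q"
  obtain e :: 'a where e: "norm e = 1" "c - d = dist c d *\<^sub>R e"
  proof (cases "c = d")
    case True
    obtain e :: 'a where "norm e = 1" using vector_choose_size[of 1] by auto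
    then show ?thesis using that True by simp
  next
    case False
    then show ?thesis using that[of "sgn (c - d)"] by (simp add: norm_sgn sgn_div_norm dist_norm)
  qed
  let ?f = "\<lambda>x. dist d x"
  have D: "dist d (c + t *\<^sub>R e) = \<bar>dist c d + t\<bar>" for t
  proof -
    have "d - (c + t *\<^sub>R e) = - (dist c d + t) *\<^sub>R e" using e(2) by (simp add: algebra_simps)
    then show ?thesis by (simp add: dist_norm[of d] e)
  qed
  have "connected (?f ` sphere c r)"
    using assms by (intro connected_continuous_image continuous_intros connected_sphere)
  moreover have "c + r *\<^sub>R e \<in> sphere c r" "c + (-r) *\<^sub>R e \<in> sphere c r"
    using e assms by (auto simp: dist_norm)
  then have "\<bar>dist c d + r\<bar> \<in> ?f ` sphere c r" "\<bar>dist c d - r\<bar> \<in> ?f ` sphere c r"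
    using D[of r] D[of "-r"] by (metis imageI, metis imageI add_uminus_conv_diff)
  ultimately have "q \<in> ?f ` sphere c r"
    using h assms by (intro connectedD_interval[of "?f ` sphere c r" "\<bar>dist c d - r\<bar>" "\<bar>dist c d + r\<bar>" q]) auto
  then show "sphere c r \<inter> sphere d q \<noteq> {}" by auto
qed

lemma tangent_spheres_meet_iff:
  fixes z u v :: "'a::euclidean_space"
  assumes "DIM('a) \<ge> 2" "norm u = 1" "norm v = 1" "u \<noteq> v" "s \<noteq> R" "t \<noteq> R"
  shows "sphere (z + (R - s) *\<^sub>R u) \<bar>s\<bar> \<inter> sphere (z + (R - t) *\<^sub>R v) \<bar>t\<bar> \<noteq> {} \<longleftrightarrow>
    (norm (u - v))\<^sup>2 \<le> 4 * (s / (R - s)) * (t / (R - t))"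
proof -
  define D where "D = dist (z + (R - s) *\<^sub>R u) (z + (R - t) *\<^sub>R v)"
  define N where "N = (norm (u - v))\<^sup>2"
  have N: "N > 0" using assms by (simp add: N_def)
  have uv: "u \<bullet> u = 1" "v \<bullet> v = 1" using assms by (simp_all add: dot_square_norm)
  have N2: "N = 2 - 2 * (u \<bullet> v)"
    unfolding N_def power2_norm_eq_inner by (simp add: inner_diff inner_commute uv)
  have D2: "D\<^sup>2 = (s - t)\<^sup>2 + (R - s) * (R - t) * N"
  proof -
    have "D\<^sup>2 = (norm ((R - s) *\<^sub>R u - (R - t) *\<^sub>R v))\<^sup>2" by (simp add: D_def dist_norm)
    also have "\<dots> = (R - s)\<^sup>2 + (R - t)\<^sup>2 - 2 * (R - s) * (R - t) * (u \<bullet> v)"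
      unfolding power2_norm_eq_inner by (simp add: inner_diff inner_commute uv power2_eq_square algebra_simps)
    also have "\<dots> = (s - t)\<^sup>2 + (R - s) * (R - t) * N"
      unfolding N2 by (simp add: power2_eq_square algebra_simps)
    finally show ?thesis .
  qed
  have "D \<ge> 0" by (simp add: D_def)
  have 1: "\<bar>\<bar>s\<bar> - \<bar>t\<bar>\<bar> \<le> D \<longleftrightarrow> (\<bar>s\<bar> - \<bar>t\<bar>)\<^sup>2 \<le> D\<^sup>2"
    using \<open>D \<ge> 0\<close> by (metis abs_le_square_iff abs_of_nonneg)
  have 2: "D \<le> \<bar>s\<bar> + \<bar>t\<bar> \<longleftrightarrow> D\<^sup>2 \<le> (\<bar>s\<bar> + \<bar>t\<bar>)\<^sup>2"
    using \<open>D \<ge> 0\<close> by (metis abs_ge_zero add_nonneg_nonneg power2_le_imp_le power_mono)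
  \<comment> \<open>\<open>(\<bar>s\<bar> - \<bar>t\<bar>)\<^sup>2\<close> and \<open>(\<bar>s\<bar> + \<bar>t\<bar>)\<^sup>2\<close> are \<open>(s - t)\<^sup>2\<close> and \<open>(s + t)\<^sup>2\<close> in some order.\<close>
  have "\<bar>\<bar>s\<bar> - \<bar>t\<bar>\<bar> \<le> D \<and> D \<le> \<bar>s\<bar> + \<bar>t\<bar> \<longleftrightarrow> (D\<^sup>2 - (s - t)\<^sup>2) * (D\<^sup>2 - (s + t)\<^sup>2) \<le> 0"
  proof -
    have a: "(\<bar>s\<bar> - \<bar>t\<bar>)\<^sup>2 \<le> (\<bar>s\<bar> + \<bar>t\<bar>)\<^sup>2" by (simp add: power2_eq_square algebra_simps)
    have b: "(D\<^sup>2 - (s - t)\<^sup>2) * (D\<^sup>2 - (s + t)\<^sup>2) = (D\<^sup>2 - (\<bar>s\<bar> - \<bar>t\<bar>)\<^sup>2) * (D\<^sup>2 - (\<bar>s\<bar> + \<bar>t\<bar>)\<^sup>2)"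
      by (cases "s \<ge> 0"; cases "t \<ge> 0") (auto simp: power2_eq_square algebra_simps)
    show ?thesis unfolding 1 2 b mult_le_0_iff using a by linarith
  qed
  also have "\<dots> \<longleftrightarrow> ((R - s) * (R - t))\<^sup>2 * N * (N - 4 * (s / (R - s)) * (t / (R - t))) \<le> 0"
  proof -
    have "D\<^sup>2 - (s + t)\<^sup>2 = (R - s) * (R - t) * (N - 4 * (s / (R - s)) * (t / (R - t)))"
    proof -
      have "D\<^sup>2 - (s + t)\<^sup>2 = (R - s) * (R - t) * N - 4 * s * t"
        unfolding D2 by (simp add: power2_eq_square algebra_simps)
      moreover have "(R - s) * (R - t) * (4 * (s / (R - s)) * (t / (R - t))) = 4 * s * t"
        using assms(5,6) by simp
      ultimately show ?thesis by (simp add: right_diff_distrib)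
    qed
    moreover have "D\<^sup>2 - (s - t)\<^sup>2 = (R - s) * (R - t) * N" unfolding D2 by simp
    ultimately show ?thesis by (simp add: power2_eq_square mult.assoc mult.left_commute)
  qed
  also have "\<dots> \<longleftrightarrow> N \<le> 4 * (s / (R - s)) * (t / (R - t))"
  proof -
    have "((R - s) * (R - t))\<^sup>2 * N > 0" using N assms(5,6) by simp
    moreover have "P * X \<le> 0 \<longleftrightarrow> X \<le> 0" if "P > 0" for P X :: real
      using that by (simp add: mult_le_0_iff)
    ultimately show ?thesis by simp
  qed
  finally show ?thesis using assms(1) unfolding N_def D_def by (subst spheres_meet_iff) auto
qed

section \<open>Division of a circle by finitely many points\<close>

definition unit_at :: "real \<Rightarrow> real^2" where
  "unit_at t = vector [cos t, sin t]"

definition circle_at :: "real^2 \<Rightarrow> real \<Rightarrow> real \<Rightarrow> real^2" where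
  "circle_at z r t = z + r *\<^sub>R unit_at t"

lemma unit_at_nth [simp]: "unit_at t $ 1 = cos t" "unit_at t $ 2 = sin t"
  by (simp_all add: unit_at_def)

lemma norm_unit_at [simp]: "norm (unit_at t) = 1"
  by (simp add: norm_eq_sqrt_inner inner_vec_def sum_2 flip: power2_eq_square)

lemma unit_at_eq_iff: "unit_at s = unit_at t \<longleftrightarrow> (\<exists>n::int. s = t + 2 * pi * n)"
  unfolding sin_cos_eq_iff[symmetric] by (auto simp: vec_eq_iff forall_2)

lemma unit_at_add_2pi [simp]: "unit_at (t + 2 * pi) = unit_at t"
  by (simp add: vec_eq_iff forall_2)

lemma unit_at_eq_imp_eq:
  assumes "unit_at s = unit_at t" "\<bar>s - t\<bar> < 2 * pi"
  shows "s = t"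
proof -
  obtain n :: int where n: "s = t + 2 * pi * n" using assms(1) unit_at_eq_iff by auto
  then have "2 * pi * \<bar>real_of_int n\<bar> < 2 * pi * 1" using assms(2) by (simp add: abs_mult)
  then have "\<bar>real_of_int n\<bar> < 1" by (subst (asm) mult_less_cancel_left_pos) auto
  then show ?thesis using n by auto
qed

lemma norm_unit_at_diff: "(norm (unit_at s - unit_at t))\<^sup>2 = 4 * (sin ((s - t) / 2))\<^sup>2"
proof -
  have 1: "(norm (unit_at s - unit_at t))\<^sup>2 = 2 - 2 * cos (s - t)"
    using sin_cos_squared_add[of s] sin_cos_squared_add[of t]
    unfolding power2_norm_eq_inner
    by (simp add: inner_vec_def sum_2 cos_diff power2_eq_square algebra_simps)
  have "cos (s - t) = 1 - 2 * (sin ((s - t) / 2))\<^sup>2"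
    using cos_double_sin[of "(s - t) / 2"] by (metis field_sum_of_halves mult_2)
  then show ?thesis unfolding 1 by simp
qed

lemma continuous_on_circle_at [continuous_intros]: "continuous_on A (circle_at z r)"
proof -
  have "circle_at z r = (\<lambda>t. \<chi> i. if i = 1 then z $ 1 + r * cos t else z $ 2 + r * sin t)"
    by (auto simp: circle_at_def fun_eq_iff vec_eq_iff forall_2)
  moreover have "continuous_on A \<dots>"
  proof (rule continuous_on_vec_lambda)
    show "continuous_on A (\<lambda>t. if i = 1 then z $ 1 + r * cos t else z $ 2 + r * sin t)" for i :: 2
      by (cases "i = 1") (auto intro!: continuous_intros)
  qed
  ultimately show ?thesis by simp
qed

lemma circle_at_eq_iff: "r > 0 \<Longrightarrow> circle_at z r s = circle_at z r t \<longleftrightarrow> unit_at s = unit_at t"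
  by (simp add: circle_at_def)

lemma circle_at_add_2pi [simp]: "circle_at z r (t + 2 * pi) = circle_at z r t"
  by (simp add: circle_at_def)

lemma sphere_eq_circle_at:
  assumes "r > 0"
  shows "sphere z r = circle_at z r ` {a..<a + 2 * pi}"
proof
  show "circle_at z r ` {a..<a + 2 * pi} \<subseteq> sphere z r"
    using assms by (auto simp: circle_at_def dist_norm)
  show "sphere z r \<subseteq> circle_at z r ` {a..<a + 2 * pi}"
  proof
    fix p assume p: "p \<in> sphere z r"
    define u where "u = (1 / r) *\<^sub>R (p - z)"
    have pu: "p = z + r *\<^sub>R u" using assms by (simp add: u_def)
    have "norm u = 1" using p assms by (simp add: u_def dist_norm norm_minus_commute)
    then have "(u $ 1)\<^sup>2 + (u $ 2)\<^sup>2 = 1"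
      by (simp add: norm_eq_sqrt_inner inner_vec_def sum_2 power2_eq_square)
    then obtain t where "u $ 1 = cos t" "u $ 2 = sin t" using sincos_total_2pi by metis
    then have ut: "u = unit_at t" by (simp add: vec_eq_iff forall_2)
    define n where "n = \<lfloor>(t - a) / (2 * pi)\<rfloor>"
    define s where "s = t - 2 * pi * n"
    have "n \<le> (t - a) / (2 * pi)" "(t - a) / (2 * pi) < n + 1" unfolding n_def by linarith+
    then have "s \<in> {a..<a + 2 * pi}" by (auto simp: s_def field_simps)
    moreover have "unit_at s = u" unfolding ut unit_at_eq_iff s_def by (rule exI[of _ "- n"]) simp
    ultimately show "p \<in> circle_at z r ` {a..<a + 2 * pi}"
      unfolding pu circle_at_def by blast
  qed
qed

lemma arc_between_points:
  assumes "r > 0" "a < b" "b \<le> a + 2 * pi"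
    and S: "circle_at z r a \<in> S" "circle_at z r b \<in> S"
    and gap: "\<And>t. a < t \<Longrightarrow> t < b \<Longrightarrow> circle_at z r t \<notin> S"
  shows "circle_at z r ` {a<..<b} \<in> components (sphere z r - S)"
    and "arc_ends (circle_at z r ` {a<..<b}) = {circle_at z r a, circle_at z r b}"
proof -
  let ?c = "circle_at z r"
  let ?U = "?c ` {a<..<b}"
  have inj: "x = y" if "?c x = ?c y" "\<bar>x - y\<bar> < 2 * pi" for x y
    using that assms(1) by (simp add: circle_at_eq_iff unit_at_eq_imp_eq)
  have Us: "?U \<subseteq> sphere z r - S"
    using gap assms(1) by (auto simp: circle_at_def dist_norm)
  have "?U \<noteq> {}" "connected ?U"
    using assms(2) by (auto intro!: connected_continuous_image continuous_intros)
  moreover have "D = ?U" if D: "?U \<subseteq> D" "D \<subseteq> sphere z r - S" "connected D" for D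
  proof -
    let ?A = "?c ` {a..b}" and ?B = "?c ` {b..a + 2 * pi}"
    have "closed ?A" "closed ?B"
      by (auto intro!: compact_imp_closed compact_continuous_image continuous_intros)
    moreover have "sphere z r \<subseteq> ?A \<union> ?B"
      unfolding sphere_eq_circle_at[OF assms(1), of z a] by force
    then have "D \<subseteq> ?A \<union> ?B" using D by blast
    moreover have AU: "?A - S \<subseteq> ?U"
      using S by (force simp: less_le)
    have "?U \<inter> ?B \<subseteq> S"
    proof
      fix p assume "p \<in> ?U \<inter> ?B"
      then obtain x y where *: "x \<in> {a<..<b}" "y \<in> {b..a + 2 * pi}" "?c x = ?c y" "p = ?c y"
        by auto
      then have "x = y" by (intro inj) auto
      then show "p \<in> S" using * S by auto
    qed
    then have "?A \<inter> ?B \<inter> D = {}" using AU D by blast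
    moreover have "?A \<inter> D \<noteq> {}"
    proof -
      have "?U \<subseteq> ?A" by force
      then show ?thesis using D(1) \<open>?U \<noteq> {}\<close> by blast
    qed
    ultimately have "?B \<inter> D = {}" using D(3) unfolding connected_closed by blast
    then have "D \<subseteq> ?A" using \<open>D \<subseteq> ?A \<union> ?B\<close> by blast
    then show ?thesis using D(1,2) AU by blast
  qed
  ultimately show "?U \<in> components (sphere z r - S)"
    unfolding in_components_maximal using Us by blast
  have "closure ?U = ?c ` {a..b}"
  proof
    show "closure ?U \<subseteq> ?c ` {a..b}"
      by (rule closure_minimal)
        (force, auto intro!: compact_imp_closed compact_continuous_image continuous_intros)
    have "?c ` closure {a<..<b} \<subseteq> closure ?U"
      by (rule image_closure_subset) (auto intro: continuous_intros closure_subset[THEN subsetD])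
    then show "?c ` {a..b} \<subseteq> closure ?U" using assms(2) by simp
  qed
  moreover have "?c ` {a..b} = insert (?c a) (insert (?c b) ?U)"
    using assms(2) by (auto simp: image_iff less_le)
  moreover have "?c a \<notin> ?U" "?c b \<notin> ?U" using S Us by blast+
  ultimately show "arc_ends ?U = {?c a, ?c b}" unfolding arc_ends_def by auto
qed

lemma circle_division:
  assumes r: "r > 0" and fin: "finite (sphere z r \<inter> S)" and p: "p \<in> sphere z r \<inter> S"
  obtains \<theta> where
    "strict_mono_on {..card (sphere z r \<inter> S)} \<theta>"
    "\<theta> (card (sphere z r \<inter> S)) = \<theta> 0 + 2 * pi" "circle_at z r (\<theta> 0) = p"
    "bij_betw (\<lambda>i. circle_at z r (\<theta> i)) {..<card (sphere z r \<inter> S)} (sphere z r \<inter> S)"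
    "\<And>i. i < card (sphere z r \<inter> S) \<Longrightarrow>
      circle_at z r ` {\<theta> i<..<\<theta> (Suc i)} \<in> components (sphere z r - S)"
    "\<And>i. i < card (sphere z r \<inter> S) \<Longrightarrow> arc_ends (circle_at z r ` {\<theta> i<..<\<theta> (Suc i)}) =
      {circle_at z r (\<theta> i), circle_at z r (\<theta> (Suc i))}"
proof -
  let ?c = "circle_at z r" and ?X = "sphere z r \<inter> S"
  obtain a where a: "?c a = p" using p unfolding sphere_eq_circle_at[OF r, of z 0] by auto
  define T where "T = {t \<in> {a..<a + 2 * pi}. ?c t \<in> S}"
  have injT: "inj_on ?c {a..<a + 2 * pi}"
    by (rule inj_onI) (use r in \<open>auto simp: circle_at_eq_iff intro!: unit_at_eq_imp_eq\<close>)
  have imT: "?c ` T = ?X"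
    unfolding sphere_eq_circle_at[OF r, of z a] T_def by auto
  have bT: "bij_betw ?c T ?X"
    unfolding bij_betw_def using imT injT by (auto simp: T_def intro: inj_on_subset)
  have finT: "finite T" and cT: "card T = card ?X"
    using bT fin bij_betw_finite bij_betw_same_card by auto
  have aT: "a \<in> T" using a p by (auto simp: T_def)
  define L where "L = sorted_list_of_set T"
  define n where "n = card ?X"
  have L: "sorted_wrt (<) L" "set L = T" "length L = n" "distinct L"
    using finT by (simp_all add: L_def n_def cT)
  have n: "n > 0" using aT L by (metis length_pos_if_in_set)
  define \<theta> where "\<theta> i = (if i < n then L ! i else a + 2 * pi)" for i
  have \<theta>T: "\<theta> i \<in> T" if "i < n" for i
    using that L(2,3) nth_mem[of i L] by (simp add: \<theta>_def)
  have mono: "strict_mono_on {..n} \<theta>"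
  proof (rule strict_mono_onI)
    fix i j assume ij: "i \<in> {..n}" "j \<in> {..n}" "i < j"
    show "\<theta> i < \<theta> j"
    proof (cases "j < n")
      case True
      then show ?thesis using ij L(1,3) by (simp add: \<theta>_def sorted_wrt_iff_nth_less)
    next
      case False
      then have "\<theta> j = a + 2 * pi" by (simp add: \<theta>_def)
      then show ?thesis using \<theta>T[of i] ij by (simp add: T_def)
    qed
  qed
  have onto: "\<exists>i<n. \<theta> i = t" if "t \<in> T" for t
  proof -
    obtain i where "i < n" "L ! i = t" using \<open>t \<in> T\<close> L(2,3) by (metis in_set_conv_nth)
    then show ?thesis by (auto simp: \<theta>_def)
  qed
  have \<theta>0: "\<theta> 0 = a"
  proof -
    obtain i where i: "i < n" "\<theta> i = a" using onto aT by blast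
    have "\<theta> 0 \<ge> a" using \<theta>T n by (auto simp: T_def)
    then have "i = 0" using i strict_mono_onD[OF mono, of 0 i] by force
    then show ?thesis using i by simp
  qed
  have \<theta>n: "\<theta> n = \<theta> 0 + 2 * pi" unfolding \<theta>0 by (simp add: \<theta>_def)
  have cS: "?c (\<theta> i) \<in> S" if "i \<le> n" for i
  proof (cases "i < n")
    case True
    then show ?thesis using \<theta>T by (auto simp: T_def)
  next
    case False
    then show ?thesis using that \<theta>n \<theta>0 a p by (simp add: order.strict_iff_order)
  qed
  have gap: "?c t \<notin> S" if "i < n" "\<theta> i < t" "t < \<theta> (Suc i)" for i t
  proof
    assume "?c t \<in> S"
    have le: "\<theta> j \<le> \<theta> k" if "j \<le> k" "k \<le> n" for j k
      using strict_mono_onD[OF mono, of j k] that by (cases "j = k") auto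
    have "a \<le> t" "t < a + 2 * pi"
      using le[of 0 i] le[of "Suc i" n] that \<theta>0 \<theta>n by auto
    then have "t \<in> T" using \<open>?c t \<in> S\<close> by (simp add: T_def)
    then obtain j where "j < n" "\<theta> j = t" using onto by blast
    then show False using le[of j i] le[of "Suc i" j] that by (cases "j \<le> i") auto
  qed
  have step: "\<theta> i < \<theta> (Suc i)" "\<theta> (Suc i) \<le> \<theta> i + 2 * pi" if "i < n" for i
  proof -
    show "\<theta> i < \<theta> (Suc i)" using strict_mono_onD[OF mono] that by auto
    have "\<theta> 0 \<le> \<theta> i" using strict_mono_onD[OF mono, of 0 i] that by (cases "i = 0") auto
    moreover have "\<theta> (Suc i) \<le> \<theta> n"
      using strict_mono_onD[OF mono, of "Suc i" n] that by (cases "Suc i = n") auto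
    ultimately show "\<theta> (Suc i) \<le> \<theta> i + 2 * pi" using \<theta>n by simp
  qed
  have bij: "bij_betw (\<lambda>i. ?c (\<theta> i)) {..<n} ?X"
  proof -
    have "bij_betw \<theta> {..<n} T"
      unfolding bij_betw_def
    proof
      show "inj_on \<theta> {..<n}"
        by (rule inj_on_subset[OF strict_mono_on_imp_inj_on[OF mono]]) auto
      show "\<theta> ` {..<n} = T" using \<theta>T onto by auto
    qed
    from bij_betw_trans[OF this bT] show ?thesis by (simp add: comp_def)
  qed
  show ?thesis
    by (rule that[of \<theta>, folded n_def])
      (use mono \<theta>n \<theta>0 a bij arc_between_points[OF r step cS cS gap] in auto)
qed

section \<open>Multigraphs represented by circles\<close>

locale represented_multigraph =
  fixes \<C> :: "(real^2) set set" and G :: "'v multigraph"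
    and \<phi> :: "real^2 \<Rightarrow> 'v" and \<psi> :: "(real^2) set \<Rightarrow> 'v uprod \<times> nat"
  assumes circles: "C \<in> \<C> \<Longrightarrow> is_circle C"
    and finite_circles_through: "finite (circles_through \<C> p)"
    and card_circles_through_le: "card (circles_through \<C> p) \<le> 2"
    and bij_points: "bij_betw \<phi> (double_points \<C>) (verts G)"
    and bij_arcs: "bij_betw \<psi> (circle_arcs \<C>) (edge_copies G)"
    and ends: "A \<in> circle_arcs \<C> \<Longrightarrow> set_uprod (fst (\<psi> A)) = \<phi> ` arc_ends A"
    and finite_verts: "finite (verts G)"
begin

definition pt :: "'v \<Rightarrow> real^2" where
  "pt = inv_into (double_points \<C>) \<phi>"

definition verts_on :: "(real^2) set \<Rightarrow> 'v set" where
  "verts_on C = {v \<in> verts G. pt v \<in> C}"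

definition arcs_joining :: "'v \<Rightarrow> 'v \<Rightarrow> (real^2) set set" where
  "arcs_joining v w = {A \<in> circle_arcs \<C>. arc_ends A = {pt v, pt w}}"

lemma bij_pt: "bij_betw pt (verts G) (double_points \<C>)"
  unfolding pt_def using bij_points by (rule bij_betw_inv_into)

lemma pt_phi [simp]: "p \<in> double_points \<C> \<Longrightarrow> pt (\<phi> p) = p"
  unfolding pt_def using bij_points by (simp add: bij_betw_def)

lemma phi_pt [simp]: "v \<in> verts G \<Longrightarrow> \<phi> (pt v) = v"
  unfolding pt_def using bij_points by (simp add: bij_betw_def f_inv_into_f)

lemma pt_double_point [simp]: "v \<in> verts G \<Longrightarrow> pt v \<in> double_points \<C>"
  using bij_pt by (auto simp: bij_betw_def)

lemma phi_verts [simp]: "p \<in> double_points \<C> \<Longrightarrow> \<phi> p \<in> verts G"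
  using bij_points by (auto simp: bij_betw_def)

lemma pt_eq_iff [simp]: "v \<in> verts G \<Longrightarrow> w \<in> verts G \<Longrightarrow> pt v = pt w \<longleftrightarrow> v = w"
  using bij_pt by (auto simp: bij_betw_def inj_on_def)

lemma double_points_on: "C \<inter> double_points \<C> = pt ` verts_on C"
  using bij_pt by (auto simp: bij_betw_def verts_on_def)

lemma finite_double_points: "finite (double_points \<C>)"
  using bij_pt finite_verts bij_betw_finite by auto

lemma card_double_points_on: "card (C \<inter> double_points \<C>) = card (verts_on C)"
  unfolding double_points_on by (rule card_image) (auto simp: inj_on_def verts_on_def)

lemma double_pointI:
  assumes "C \<in> \<C>" "D \<in> \<C>" "C \<noteq> D" "p \<in> C" "p \<in> D"
  shows "p \<in> double_points \<C>"
proof -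
  have "{C, D} \<subseteq> circles_through \<C> p" using assms by (auto simp: circles_through_def)
  from card_mono[OF finite_circles_through this] have "card (circles_through \<C> p) \<ge> 2"
    using assms by simp
  then show ?thesis using card_circles_through_le[of p] by (simp add: double_points_def)
qed

lemma two_circles_at:
  assumes "v \<in> verts G"
  obtains C D where "C \<noteq> D" "circles_through \<C> (pt v) = {C, D}"
  using pt_double_point[OF assms] that unfolding double_points_def by (auto simp: card_2_iff)

lemma circles_at_eq:
  assumes "v \<in> verts G" "C \<in> \<C>" "D \<in> \<C>" "C \<noteq> D" "v \<in> verts_on C" "v \<in> verts_on D"
  shows "circles_through \<C> (pt v) = {C, D}"
proof -
  have "{C, D} \<subseteq> circles_through \<C> (pt v)"
    using assms by (auto simp: circles_through_def verts_on_def)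
  moreover obtain C' D' where "C' \<noteq> D'" "circles_through \<C> (pt v) = {C', D'}"
    using two_circles_at[OF assms(1)] .
  ultimately show ?thesis using assms(4) by auto
qed

lemma three_common_verts:
  assumes "C \<in> \<C>" "D \<in> \<C>" "{u, v, w} \<subseteq> verts_on C \<inter> verts_on D" "u \<noteq> v" "u \<noteq> w" "v \<noteq> w"
  shows "C = D"
proof -
  obtain z r y q where "C = sphere z r" "D = sphere y q"
    using circles assms(1,2) unfolding is_circle_def by metis
  moreover have "{pt u, pt v, pt w} \<subseteq> C \<inter> D" "pt u \<noteq> pt v" "pt u \<noteq> pt w" "pt v \<noteq> pt w"
    using assms(3-) by (auto simp: verts_on_def)
  ultimately show ?thesis using spheres_three_common_points by metis
qed

lemma finite_arcs_joining:
  assumes "v \<in> verts G" "w \<in> verts G"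
  shows "finite (arcs_joining v w) \<and> card (arcs_joining v w) \<le> count (edges G) (Upair v w)"
proof -
  let ?E = "{Upair v w} \<times> {..<count (edges G) (Upair v w)}"
  have "inj_on \<psi> (arcs_joining v w)"
    using bij_arcs by (auto simp: bij_betw_def arcs_joining_def intro: inj_on_subset)
  moreover have "\<psi> ` arcs_joining v w \<subseteq> ?E"
  proof
    fix e assume "e \<in> \<psi> ` arcs_joining v w"
    then obtain A where A: "A \<in> circle_arcs \<C>" "arc_ends A = {pt v, pt w}" "e = \<psi> A"
      by (auto simp: arcs_joining_def)
    have "e \<in> edge_copies G" using A bij_arcs by (auto simp: bij_betw_def)
    then have "snd e < count (edges G) (fst e)" by (auto simp: edge_copies_def)
    moreover have "set_uprod (fst e) = {v, w}" using ends[OF A(1)] A assms by simp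
    then have "fst e = Upair v w" by (cases "fst e") (auto simp: doubleton_eq_iff)
    ultimately show "e \<in> ?E" by (cases e) auto
  qed
  moreover have "finite ?E" "card ?E = count (edges G) (Upair v w)" by simp_all
  ultimately show ?thesis by (metis card_inj_on_le inj_on_finite)
qed

lemma card_arcs_le:
  assumes "v \<in> verts G" "w \<in> verts G" "F \<subseteq> arcs_joining v w"
  shows "card F \<le> count (edges G) (Upair v w)"
  using finite_arcs_joining[OF assms(1,2)] card_mono[OF _ assms(3)] by fastforce

lemma arc_joining_imp_edge:
  assumes "v \<in> verts G" "w \<in> verts G" "A \<in> arcs_joining v w"
  shows "count (edges G) (Upair v w) > 0"
  using card_arcs_le[of v w "{A}"] assms by auto

lemma arcs_on_distinct_circles:
  assumes "C \<in> \<C>" "D \<in> \<C>" "C \<noteq> D" "A \<subseteq> C - double_points \<C>" "A \<noteq> {}"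
    "B \<subseteq> D - double_points \<C>"
  shows "A \<noteq> B"
  using assms double_pointI[OF assms(1-3)] by blast

lemma common_points:
  assumes "C \<in> \<C>" "D \<in> \<C>" "C \<noteq> D"
  shows "C \<inter> D = pt ` (verts_on C \<inter> verts_on D)"
proof
  show "C \<inter> D \<subseteq> pt ` (verts_on C \<inter> verts_on D)"
  proof
    fix p assume p: "p \<in> C \<inter> D"
    then have "p \<in> double_points \<C>" using double_pointI[OF assms] by blast
    then have "p = pt (\<phi> p)" by simp
    moreover have "\<phi> p \<in> verts_on C \<inter> verts_on D"
      using p \<open>p \<in> double_points \<C>\<close> by (simp add: verts_on_def)
    ultimately show "p \<in> pt ` (verts_on C \<inter> verts_on D)" by blast
  qed
qed (auto simp: verts_on_def)

lemma circle_cycle: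
  assumes "C \<in> \<C>" "v \<in> verts_on C"
  obtains z r \<theta> where "r > 0" "C = sphere z r"
    "strict_mono_on {..card (verts_on C)} \<theta>" "\<theta> (card (verts_on C)) = \<theta> 0 + 2 * pi"
    "circle_at z r (\<theta> 0) = pt v"
    "bij_betw (\<lambda>i. \<phi> (circle_at z r (\<theta> i))) {..<card (verts_on C)} (verts_on C)"
    "\<And>i. i \<le> card (verts_on C) \<Longrightarrow> circle_at z r (\<theta> i) \<in> double_points \<C>"
    "\<And>i. i < card (verts_on C) \<Longrightarrow> circle_at z r ` {\<theta> i<..<\<theta> (Suc i)} \<in> components (C - double_points \<C>)"
    "\<And>i. i < card (verts_on C) \<Longrightarrow> circle_at z r ` {\<theta> i<..<\<theta> (Suc i)} \<in>
      arcs_joining (\<phi> (circle_at z r (\<theta> i))) (\<phi> (circle_at z r (\<theta> (Suc i))))"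
proof -
  let ?S = "double_points \<C>" and ?n = "card (verts_on C)"
  obtain z r where r: "r > 0" "C = sphere z r" using circles[OF assms(1)] by (auto simp: is_circle_def)
  have v: "v \<in> verts G" "pt v \<in> sphere z r \<inter> ?S" using assms(2) r by (auto simp: verts_on_def)
  have n: "card (sphere z r \<inter> ?S) = ?n" unfolding r(2)[symmetric] by (rule card_double_points_on)
  obtain \<theta> where \<theta>: "strict_mono_on {..?n} \<theta>" "\<theta> ?n = \<theta> 0 + 2 * pi" "circle_at z r (\<theta> 0) = pt v"
    "bij_betw (\<lambda>i. circle_at z r (\<theta> i)) {..<?n} (sphere z r \<inter> ?S)"
    "\<And>i. i < ?n \<Longrightarrow> circle_at z r ` {\<theta> i<..<\<theta> (Suc i)} \<in> components (sphere z r - ?S)"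
    "\<And>i. i < ?n \<Longrightarrow> arc_ends (circle_at z r ` {\<theta> i<..<\<theta> (Suc i)}) =
      {circle_at z r (\<theta> i), circle_at z r (\<theta> (Suc i))}"
    using circle_division[OF r(1) _ v(2)] finite_double_points unfolding n by (metis finite_Int)
  have dp: "circle_at z r (\<theta> i) \<in> ?S" if "i \<le> ?n" for i
  proof (cases "i = ?n")
    case True
    then show ?thesis using \<theta>(2,3) v by simp
  next
    case False
    then show ?thesis using \<theta>(4) that by (auto simp: bij_betw_def)
  qed
  show ?thesis
  proof (rule that[OF r \<theta>(1-3)])
    have "bij_betw \<phi> (C \<inter> ?S) (verts_on C)"
      unfolding double_points_on bij_betw_def
      by (force simp: inj_on_def verts_on_def image_iff)
    from bij_betw_trans[OF \<theta>(4)[folded r(2)] this]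
    show "bij_betw (\<lambda>i. \<phi> (circle_at z r (\<theta> i))) {..<?n} (verts_on C)" by (simp add: comp_def)
    show "circle_at z r (\<theta> i) \<in> ?S" if "i \<le> ?n" for i using that by (rule dp)
    fix i assume i: "i < ?n"
    show comp: "circle_at z r ` {\<theta> i<..<\<theta> (Suc i)} \<in> components (C - ?S)" using \<theta>(5)[OF i] r by simp
    have "C \<inter> ?S \<noteq> {}" using v r by auto
    then have "circle_at z r ` {\<theta> i<..<\<theta> (Suc i)} \<in> circle_arcs \<C>"
      unfolding circle_arcs_def using comp assms(1) by blast
    then show "circle_at z r ` {\<theta> i<..<\<theta> (Suc i)} \<in>
      arcs_joining (\<phi> (circle_at z r (\<theta> i))) (\<phi> (circle_at z r (\<theta> (Suc i))))"
      using \<theta>(6)[OF i] dp[of i] dp[of "Suc i"] i by (simp add: arcs_joining_def)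
  qed
qed

lemma arcs_joining_commute: "arcs_joining v w = arcs_joining w v"
  by (simp add: arcs_joining_def insert_commute)

lemma two_arcs_at:
  assumes "C \<in> \<C>" "v \<in> verts_on C" and no_loop: "count (edges G) (Upair v v) = 0"
  obtains A B w x where "A \<in> arcs_joining v w" "B \<in> arcs_joining v x" "A \<noteq> B"
    "A \<subseteq> C - double_points \<C>" "B \<subseteq> C - double_points \<C>" "A \<noteq> {}" "B \<noteq> {}"
    "w \<in> verts_on C" "x \<in> verts_on C" "w = x \<longrightarrow> verts_on C = {v, w}"
proof -
  let ?n = "card (verts_on C)"
  obtain z r \<theta> where \<theta>: "r > 0" "C = sphere z r"
    "strict_mono_on {..?n} \<theta>" "\<theta> ?n = \<theta> 0 + 2 * pi" "circle_at z r (\<theta> 0) = pt v"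
    "bij_betw (\<lambda>i. \<phi> (circle_at z r (\<theta> i))) {..<?n} (verts_on C)"
    "\<And>i. i < ?n \<Longrightarrow> circle_at z r ` {\<theta> i<..<\<theta> (Suc i)} \<in> components (C - double_points \<C>)"
    "\<And>i. i < ?n \<Longrightarrow> circle_at z r ` {\<theta> i<..<\<theta> (Suc i)} \<in>
      arcs_joining (\<phi> (circle_at z r (\<theta> i))) (\<phi> (circle_at z r (\<theta> (Suc i))))"
    using circle_cycle[OF assms(1,2)] by metis
  define q where "q i = \<phi> (circle_at z r (\<theta> i))" for i
  define A where "A i = circle_at z r ` {\<theta> i<..<\<theta> (Suc i)}" for i
  have v: "v \<in> verts G" using assms(2) by (simp add: verts_on_def)
  have q: "q 0 = v" "q ?n = v" using \<theta>(4,5) v by (simp_all add: q_def)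
  have qV: "q i \<in> verts_on C" if "i < ?n" for i using \<theta>(6) that by (auto simp: bij_betw_def q_def)
  have qinj: "i = j" if "i < ?n" "j < ?n" "q i = q j" for i j
    using \<theta>(6) that by (auto simp: bij_betw_def inj_on_def q_def)
  have A: "A i \<in> arcs_joining (q i) (q (Suc i))" "A i \<in> components (C - double_points \<C>)" if "i < ?n" for i
    using \<theta>(7,8) that by (simp_all add: A_def q_def)
  have n0: "?n > 0" using assms(2) finite_verts by (auto simp: card_gt_0_iff verts_on_def)
  have n1: "?n \<noteq> 1"
  proof
    assume "?n = 1"
    then have "A 0 \<in> arcs_joining v v" using A(1)[of 0] q by simp
    then show False using arc_joining_imp_edge[OF v v] no_loop by simp
  qed
  define m where "m = ?n - 1"
  have m: "Suc m = ?n" "0 < m" using n0 n1 by (auto simp: m_def)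
  have "A 0 \<noteq> A m"
  proof -
    have inc: "\<theta> 0 < \<theta> 1" "\<theta> 1 \<le> \<theta> m" "\<theta> m < \<theta> ?n"
      using strict_mono_onD[OF \<theta>(3), of 0 1] strict_mono_onD[OF \<theta>(3), of 1 m]
        strict_mono_onD[OF \<theta>(3), of m ?n] m by (cases "m = 1"; force)+
    define t where "t = (\<theta> 0 + \<theta> 1) / 2"
    have t: "\<theta> 0 < t" "t < \<theta> 1" using inc by (auto simp: t_def)
    then have "circle_at z r t \<in> A 0" by (auto simp: A_def)
    moreover have "circle_at z r t \<notin> A m"
    proof
      assume "circle_at z r t \<in> A m"
      then obtain t' where t': "\<theta> m < t'" "t' < \<theta> ?n" "unit_at t = unit_at t'"
        using \<theta>(1) m by (auto simp: A_def circle_at_eq_iff)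
      then have "t = t'" using t inc \<theta>(4) by (intro unit_at_eq_imp_eq) auto
      then show False using t t' inc by simp
    qed
    ultimately show ?thesis by blast
  qed
  moreover have "A 0 \<in> arcs_joining v (q 1)" using A(1)[of 0] q n0 by simp
  moreover have "A m \<in> arcs_joining v (q m)" using A(1)[of m] q m arcs_joining_commute by auto
  moreover have "verts_on C = {v, q 1}" if "q 1 = q m"
  proof -
    have "m = 1" using qinj[of 1 m] that m by auto
    then have "{..<?n} = {0, 1}" using m by auto
    moreover have "verts_on C = q ` {..<?n}" using \<theta>(6) by (simp add: bij_betw_def q_def)
    ultimately show ?thesis using q by simp
  qed
  moreover have "q 1 \<in> verts_on C" "q m \<in> verts_on C" using qV[of 1] qV[of m] m by auto
  moreover have "A 0 \<subseteq> C - double_points \<C>" "A m \<subseteq> C - double_points \<C>" "A 0 \<noteq> {}" "A m \<noteq> {}"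
    using A(2)[of 0] A(2)[of m] m in_components_subset in_components_nonempty by auto
  ultimately show ?thesis using that by blast
qed

lemma digon_pair_circles:
  assumes verts: "x \<in> verts G" "u \<in> verts G" "w \<in> verts G" "u \<noteq> w" "x \<noteq> u" "x \<noteq> w"
    and nbrs: "\<And>y. count (edges G) (Upair x y) > 0 \<Longrightarrow> y = u \<or> y = w"
    and mult: "count (edges G) (Upair x u) \<le> 2" "count (edges G) (Upair x w) \<le> 2"
  obtains C D where "C \<in> \<C>" "D \<in> \<C>" "verts_on C = {x, u}" "verts_on D = {x, w}"
proof -
  have no_loop: "count (edges G) (Upair x x) = 0" using nbrs[of x] verts by fastforce
  obtain C D where CD: "C \<noteq> D" "circles_through \<C> (pt x) = {C, D}"
    using two_circles_at[OF verts(1)] .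
  then have C: "C \<in> \<C>" "D \<in> \<C>" "x \<in> verts_on C" "x \<in> verts_on D"
    using verts by (auto simp: circles_through_def verts_on_def)
  obtain A1 A2 y1 y2 where A: "A1 \<in> arcs_joining x y1" "A2 \<in> arcs_joining x y2" "A1 \<noteq> A2"
    "A1 \<subseteq> C - double_points \<C>" "A2 \<subseteq> C - double_points \<C>" "A1 \<noteq> {}" "A2 \<noteq> {}"
    "y1 \<in> verts_on C" "y2 \<in> verts_on C" "y1 = y2 \<longrightarrow> verts_on C = {x, y1}"
    using two_arcs_at[OF C(1,3) no_loop] .
  obtain B1 B2 y3 y4 where B: "B1 \<in> arcs_joining x y3" "B2 \<in> arcs_joining x y4" "B1 \<noteq> B2"
    "B1 \<subseteq> D - double_points \<C>" "B2 \<subseteq> D - double_points \<C>" "B1 \<noteq> {}" "B2 \<noteq> {}"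
    "y3 \<in> verts_on D" "y4 \<in> verts_on D" "y3 = y4 \<longrightarrow> verts_on D = {x, y3}"
    using two_arcs_at[OF C(2,4) no_loop] .
  have AB: "A1 \<noteq> B1" "A1 \<noteq> B2" "A2 \<noteq> B1" "A2 \<noteq> B2"
    using arcs_on_distinct_circles[OF C(1,2) CD(1)] A(4-7) B(4-7) by metis+
  have "y1 = u \<or> y1 = w" "y2 = u \<or> y2 = w" "y3 = u \<or> y3 = w" "y4 = u \<or> y4 = w"
    using nbrs arc_joining_imp_edge[OF verts(1)] A B verts_on_def by auto
  moreover have three: False if "F \<subseteq> arcs_joining x y" "card F = 3" "y = u \<or> y = w" for F y
    using card_arcs_le[of x y F] that verts mult by auto
  have "\<not> (y1 = y \<and> y2 = y \<and> y3 = y)" "\<not> (y1 = y \<and> y2 = y \<and> y4 = y)"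
    "\<not> (y1 = y \<and> y3 = y \<and> y4 = y)" "\<not> (y2 = y \<and> y3 = y \<and> y4 = y)" if "y = u \<or> y = w" for y
    using three[of "{A1, A2, B1}" y] three[of "{A1, A2, B2}" y]
      three[of "{A1, B1, B2}" y] three[of "{A2, B1, B2}" y] that A(1-3) B(1-3) AB by auto
  moreover have "\<not> ({x, u, w} \<subseteq> verts_on C \<inter> verts_on D)"
    using three_common_verts[OF C(1,2), of x u w] verts CD(1) by auto
  ultimately consider "y1 = u" "y2 = u" "y3 = w" "y4 = w" | "y1 = w" "y2 = w" "y3 = u" "y4 = u"
    using A(8,9) B(8,9) C(3,4) by auto
  then show ?thesis
    using that C(1,2) A(10) B(10) by cases auto
qed

lemma second_circle_at:
  assumes verts: "x \<in> verts G" "v \<in> verts G"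
    and C: "C \<in> \<C>" "verts_on C = {x, v}"
    and nbrs: "\<And>y. count (edges G) (Upair v y) > 0 \<Longrightarrow> y = x \<or> y = l \<or> y = r"
    and mult: "count (edges G) (Upair v x) \<le> 2" "count (edges G) (Upair v l) \<le> 1"
      "count (edges G) (Upair v r) \<le> 1" "count (edges G) (Upair v v) = 0"
  obtains E where "E \<in> \<C>" "E \<noteq> C" "{v, l, r} \<subseteq> verts_on E"
proof -
  obtain E where E: "E \<noteq> C" "circles_through \<C> (pt v) = {C, E}"
  proof -
    have "C \<in> circles_through \<C> (pt v)" using C by (auto simp: circles_through_def verts_on_def)
    moreover obtain C' D where "C' \<noteq> D" "circles_through \<C> (pt v) = {C', D}"
      using two_circles_at[OF verts(2)] .
    ultimately show ?thesis using that[of C'] that[of D] by auto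
  qed
  then have E': "E \<in> \<C>" "v \<in> verts_on E"
    using verts by (auto simp: circles_through_def verts_on_def)
  obtain A1 A2 y1 y2 where A: "A1 \<in> arcs_joining v y1" "A2 \<in> arcs_joining v y2" "A1 \<noteq> A2"
    "A1 \<subseteq> C - double_points \<C>" "A2 \<subseteq> C - double_points \<C>" "A1 \<noteq> {}" "A2 \<noteq> {}"
    "y1 \<in> verts_on C" "y2 \<in> verts_on C"
  proof -
    have "v \<in> verts_on C" using C(2) by simp
    from two_arcs_at[OF C(1) this mult(4)] show ?thesis using that .
  qed
  obtain B1 B2 y3 y4 where B: "B1 \<in> arcs_joining v y3" "B2 \<in> arcs_joining v y4" "B1 \<noteq> B2"
    "B1 \<subseteq> E - double_points \<C>" "B2 \<subseteq> E - double_points \<C>" "B1 \<noteq> {}" "B2 \<noteq> {}"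
    "y3 \<in> verts_on E" "y4 \<in> verts_on E"
    using two_arcs_at[OF E' mult(4)] .
  have AB: "A1 \<noteq> B1" "A1 \<noteq> B2" "A2 \<noteq> B1" "A2 \<noteq> B2"
    using arcs_on_distinct_circles[OF C(1) E'(1) E(1)[symmetric]] A(4-7) B(4-7) by metis+
  have G: "y1 \<in> verts G" "y2 \<in> verts G" "y3 \<in> verts G" "y4 \<in> verts G"
    using A(8,9) B(8,9) by (auto simp: verts_on_def)
  have e: "count (edges G) (Upair v y1) > 0" "count (edges G) (Upair v y2) > 0"
    "count (edges G) (Upair v y3) > 0" "count (edges G) (Upair v y4) > 0"
    using arc_joining_imp_edge[OF verts(2)] A(1,2) B(1,2) G by blast+
  have "y1 \<noteq> v" "y2 \<noteq> v" using e(1,2) mult(4) by (metis less_irrefl)+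
  then have "y1 = x" "y2 = x" using A(8,9) C(2) by auto
  then have "y3 \<noteq> x" "y4 \<noteq> x"
    using card_arcs_le[OF verts(2,1), of "{A1, A2, B1}"] card_arcs_le[OF verts(2,1), of "{A1, A2, B2}"]
      mult(1) A(1-3) B(1,2) AB by auto
  moreover have "y3 \<noteq> y4"
  proof
    assume "y3 = y4"
    then have "2 \<le> count (edges G) (Upair v y3)"
      using card_arcs_le[OF verts(2) G(3), of "{B1, B2}"] B(1-3) by auto
    then show False using nbrs[OF e(3)] \<open>y3 \<noteq> x\<close> mult(2,3) by auto
  qed
  ultimately have "{y3, y4} = {l, r}" using nbrs[OF e(3)] nbrs[OF e(4)] by auto
  moreover have "{y3, y4} \<subseteq> verts_on E" using B(8,9) by blast
  ultimately have "{v, l, r} \<subseteq> verts_on E" using E'(2) by simp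
  then show ?thesis by (rule that[OF E'(1) E(1)])
qed

end

section \<open>The multigraph \<open>M\<close>\<close>

lemma verts_M [simp]: "verts M = UNIV"
proof -
  have "v \<in> verts M" for v by (cases v) (simp_all add: M_def)
  then show ?thesis by blast
qed

definition cyc :: "M_vertex set" where
  "cyc = {V1, V2, V3, V4, V5, V6, V7, V8}"

text \<open>The values of \<open>nxt\<close>, \<open>prv\<close> and \<open>hub\<close> outside \<open>cyc\<close> are junk.\<close>

fun nxt :: "M_vertex \<Rightarrow> M_vertex" where
  "nxt V1 = V2" | "nxt V2 = V3" | "nxt V3 = V4" | "nxt V4 = V5"
| "nxt V5 = V6" | "nxt V6 = V7" | "nxt V7 = V8" | "nxt V8 = V1" | "nxt v = v"

fun prv :: "M_vertex \<Rightarrow> M_vertex" where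
  "prv V1 = V8" | "prv V2 = V1" | "prv V3 = V2" | "prv V4 = V3"
| "prv V5 = V4" | "prv V6 = V5" | "prv V7 = V6" | "prv V8 = V7" | "prv v = v"

fun hub :: "M_vertex \<Rightarrow> M_vertex" where
  "hub V1 = VA" | "hub V4 = VA" | "hub V2 = VB" | "hub V7 = VB"
| "hub V3 = VC" | "hub V6 = VC" | "hub V5 = VD" | "hub V8 = VD" | "hub v = v"

lemma count_M_cyc:
  "v \<in> cyc \<Longrightarrow> count (edges M) (Upair v w) =
    (if w = hub v then 2 else if w = nxt v \<or> w = prv v then 1 else 0)"
  by (cases v; cases w) (simp_all add: M_def cyc_def)

lemma count_M_not_cyc:
  assumes "v \<notin> cyc"
  shows "count (edges M) (Upair v w) = (if w \<in> cyc \<and> hub w = v then 2 else 0)"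
  using assms by (cases v; cases w) (simp_all add: M_def cyc_def)

lemma hub_not_cyc: "v \<in> cyc \<Longrightarrow> hub v \<notin> cyc"
  by (auto simp: cyc_def)

lemma nxt_cyc: "v \<in> cyc \<Longrightarrow> nxt v \<in> cyc"
  by (auto simp: cyc_def)

lemma cyc_partner:
  "v \<in> cyc \<Longrightarrow> \<exists>w\<in>cyc. w \<noteq> v \<and> hub w = hub v \<and> (\<forall>y\<in>cyc. hub y = hub v \<longrightarrow> y = v \<or> y = w)"
  by (cases v) (simp_all add: cyc_def)

lemma hub_surj: "x \<notin> cyc \<Longrightarrow> \<exists>v\<in>cyc. hub v = x"
  by (cases x) (auto simp: cyc_def)

lemma finite_cyc: "finite cyc" "card cyc = 8"
  by (auto simp: cyc_def)

lemma cycle_walk: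
  fixes q :: "nat \<Rightarrow> M_vertex"
  assumes q0: "q 0 = V1" and inj: "inj_on q {..<8}"
    and step: "\<And>i. i < 8 \<Longrightarrow> q (Suc i) = nxt (q i) \<or> q (Suc i) = prv (q i)"
  shows "[q 1, q 2, q 3, q 4, q 5, q 6, q 7] = [V2, V3, V4, V5, V6, V7, V8] \<or>
    [q 1, q 2, q 3, q 4, q 5, q 6, q 7] = [V8, V7, V6, V5, V4, V3, V2]"
proof -
  have ne: "q (Suc (Suc i)) \<noteq> q i" if "i < 6" for i
    using inj_onD[OF inj, of "Suc (Suc i)" i] that by auto
  have "q 1 = V2 \<or> q 1 = V8" using step[of 0] q0 by auto
  then show ?thesis
  proof
    assume "q 1 = V2"
    moreover from this have "q 2 = V3" using step[of 1] ne[of 0] q0 by (auto simp: numeral_2_eq_2)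
    moreover from this have "q 3 = V4" using step[of 2] ne[of 1] \<open>q 1 = V2\<close> by (auto simp: numeral_eq_Suc)
    moreover from this have "q 4 = V5" using step[of 3] ne[of 2] \<open>q 2 = V3\<close> by (auto simp: numeral_eq_Suc)
    moreover from this have "q 5 = V6" using step[of 4] ne[of 3] \<open>q 3 = V4\<close> by (auto simp: numeral_eq_Suc)
    moreover from this have "q 6 = V7" using step[of 5] ne[of 4] \<open>q 4 = V5\<close> by (auto simp: numeral_eq_Suc)
    moreover from this have "q 7 = V8" using step[of 6] ne[of 5] \<open>q 5 = V6\<close> by (auto simp: numeral_eq_Suc)
    ultimately show ?thesis by simp
  next
    assume "q 1 = V8"
    moreover from this have "q 2 = V7" using step[of 1] ne[of 0] q0 by (auto simp: numeral_2_eq_2)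
    moreover from this have "q 3 = V6" using step[of 2] ne[of 1] \<open>q 1 = V8\<close> by (auto simp: numeral_eq_Suc)
    moreover from this have "q 4 = V5" using step[of 3] ne[of 2] \<open>q 2 = V7\<close> by (auto simp: numeral_eq_Suc)
    moreover from this have "q 5 = V4" using step[of 4] ne[of 3] \<open>q 3 = V6\<close> by (auto simp: numeral_eq_Suc)
    moreover from this have "q 6 = V3" using step[of 5] ne[of 4] \<open>q 4 = V5\<close> by (auto simp: numeral_eq_Suc)
    moreover from this have "q 7 = V2" using step[of 6] ne[of 5] \<open>q 5 = V4\<close> by (auto simp: numeral_eq_Suc)
    ultimately show ?thesis by simp
  qed
qed

locale represented_M = represented_multigraph \<C> M \<phi> \<psi> for \<C> \<phi> \<psi>
begin

lemma digon_circle: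
  assumes "v \<in> cyc"
  obtains C where "C \<in> \<C>" "verts_on C = {hub v, v}"
proof -
  obtain w where w: "w \<in> cyc" "w \<noteq> v" "hub w = hub v" "\<And>y. y \<in> cyc \<Longrightarrow> hub y = hub v \<Longrightarrow> y = v \<or> y = w"
    using cyc_partner[OF assms] by blast
  note h = hub_not_cyc[OF assms]
  obtain C D where "C \<in> \<C>" "D \<in> \<C>" "verts_on C = {hub v, v}" "verts_on D = {hub v, w}"
  proof (rule digon_pair_circles[of "hub v" v w])
    show "y = v \<or> y = w" if "count (edges M) (Upair (hub v) y) > 0" for y
      using that w(4) by (auto simp: count_M_not_cyc[OF h] split: if_splits)
  qed (use w assms h in \<open>auto simp: count_M_not_cyc[OF h]\<close>)
  then show ?thesis using that by blast
qed

lemma cycle_circle: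
  obtains E C where "E \<in> \<C>" "verts_on E = cyc"
    "\<And>v. v \<in> cyc \<Longrightarrow> C v \<in> \<C>" "\<And>v. v \<in> cyc \<Longrightarrow> verts_on (C v) = {hub v, v}"
proof -
  have "\<forall>v\<in>cyc. \<exists>C. C \<in> \<C> \<and> verts_on C = {hub v, v}" using digon_circle by metis
  then obtain C where "\<forall>v\<in>cyc. C v \<in> \<C> \<and> verts_on (C v) = {hub v, v}"
    unfolding bchoice_iff by blast
  then have C: "C v \<in> \<C>" "verts_on (C v) = {hub v, v}" if "v \<in> cyc" for v
    using that by blast+
  have "\<exists>E. E \<in> \<C> \<and> E \<noteq> C v \<and> {v, nxt v, prv v} \<subseteq> verts_on E" if v: "v \<in> cyc" for v
  proof -
    have ne: "hub v \<noteq> v" "hub v \<noteq> nxt v" "hub v \<noteq> prv v" "nxt v \<noteq> v" "prv v \<noteq> v"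
      using v by (auto simp: cyc_def)
    obtain E where "E \<in> \<C>" "E \<noteq> C v" "{v, nxt v, prv v} \<subseteq> verts_on E"
      by (rule second_circle_at[of "hub v" v "C v" "nxt v" "prv v"])
        (use v ne C in \<open>auto simp: count_M_cyc[OF v] split: if_splits\<close>)
    then show ?thesis by blast
  qed
  then have "\<forall>v\<in>cyc. \<exists>E. E \<in> \<C> \<and> E \<noteq> C v \<and> {v, nxt v, prv v} \<subseteq> verts_on E" by blast
  then obtain E where "\<forall>v\<in>cyc. E v \<in> \<C> \<and> E v \<noteq> C v \<and> {v, nxt v, prv v} \<subseteq> verts_on (E v)"
    unfolding bchoice_iff by blast
  then have E: "E v \<in> \<C>" "E v \<noteq> C v" "v \<in> verts_on (E v)" "nxt v \<in> verts_on (E v)" if "v \<in> cyc" for v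
    using that by blast+
  have E_nxt: "E (nxt v) = E v" if v: "v \<in> cyc" for v
  proof -
    let ?w = "nxt v"
    have w: "?w \<in> cyc" using nxt_cyc v by blast
    have "circles_through \<C> (pt ?w) = {C ?w, E ?w}"
      using circles_at_eq[OF _ C(1)[OF w] E(1)[OF w] E(2)[OF w, symmetric]] C(2)[OF w] E(3)[OF w] by simp
    moreover have "E v \<in> circles_through \<C> (pt ?w)"
      using E(1,4)[OF v] by (simp add: circles_through_def verts_on_def)
    moreover have "E v \<noteq> C ?w"
    proof
      assume "E v = C ?w"
      then have "v \<in> {hub ?w, ?w}" using C(2)[OF w] E(3)[OF v] by simp
      then show False using v by (auto simp: cyc_def)
    qed
    ultimately show ?thesis by auto
  qed
  have "V1 \<in> cyc" "V2 \<in> cyc" "V3 \<in> cyc" "V4 \<in> cyc" "V5 \<in> cyc" "V6 \<in> cyc" "V7 \<in> cyc" "V8 \<in> cyc"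
    by (simp_all add: cyc_def)
  then have "E V2 = E V1" "E V3 = E V2" "E V4 = E V3" "E V5 = E V4" "E V6 = E V5" "E V7 = E V6" "E V8 = E V7"
    using E_nxt[of V1] E_nxt[of V2] E_nxt[of V3] E_nxt[of V4] E_nxt[of V5] E_nxt[of V6] E_nxt[of V7] by auto
  then have E_eq: "E v = E V1" if "v \<in> cyc" for v
    using that unfolding cyc_def by (elim insertE emptyE) simp_all
  have "cyc \<subseteq> verts_on (E V1)"
  proof
    fix v assume v: "v \<in> cyc"
    show "v \<in> verts_on (E V1)" using E(3)[OF v] unfolding E_eq[OF v] .
  qed
  moreover have "verts_on (E V1) \<subseteq> cyc"
  proof
    fix x assume x: "x \<in> verts_on (E V1)"
    show "x \<in> cyc"
    proof (rule ccontr)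
      assume "x \<notin> cyc"
      from hub_surj[OF this] obtain v where v: "v \<in> cyc" "hub v = x" by (elim bexE)
      obtain w where w: "w \<in> cyc" "w \<noteq> v" "hub w = x"
        using cyc_partner[OF v(1)] unfolding v(2) by (elim bexE conjE)
      have on: "verts_on (C v) = {x, v}" "verts_on (C w) = {x, w}"
        using C(2)[OF v(1)] C(2)[OF w(1)] unfolding v(2) w(3) by simp_all
      then have "C v \<noteq> C w" using w(1,2) \<open>x \<notin> cyc\<close> by (metis doubleton_eq_iff)
      then have "circles_through \<C> (pt x) = {C v, C w}"
        by (intro circles_at_eq) (simp_all add: C(1) v(1) w(1) on)
      moreover have "E V1 \<in> circles_through \<C> (pt x)"
        using x E(1)[of V1] \<open>V1 \<in> cyc\<close> by (simp add: circles_through_def verts_on_def)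
      ultimately have "E V1 = C v \<or> E V1 = C w" by auto
      then show False using E(2)[OF v(1)] E(2)[OF w(1)] unfolding E_eq[OF v(1)] E_eq[OF w(1)] by blast
    qed
  qed
  ultimately have "verts_on (E V1) = cyc" by (rule antisym[rotated])
  then show ?thesis by (rule that[OF E(1)[OF \<open>V1 \<in> cyc\<close>] _ C])
qed

lemma cyclic_angles:
  assumes E: "E \<in> \<C>" "verts_on E = cyc"
  obtains z r a and \<sigma> :: real where "r > 0" "E = sphere z r" "\<sigma> = 1 \<or> \<sigma> = - 1"
    "\<forall>v\<in>cyc. pt v = circle_at z r (\<sigma> * a v)"
    "a V1 < a V2" "a V2 < a V3" "a V3 < a V4" "a V4 < a V5" "a V5 < a V6" "a V6 < a V7" "a V7 < a V8"
    "a V8 < a V1 + 2 * pi"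
proof -
  have "V1 \<in> verts_on E" using E by (simp add: cyc_def)
  then obtain z r \<theta> where \<theta>: "r > 0" "E = sphere z r"
    "strict_mono_on {..8} \<theta>" "\<theta> 8 = \<theta> 0 + 2 * pi" "circle_at z r (\<theta> 0) = pt V1"
    "bij_betw (\<lambda>i. \<phi> (circle_at z r (\<theta> i))) {..<8} cyc"
    "\<And>i. i \<le> 8 \<Longrightarrow> circle_at z r (\<theta> i) \<in> double_points \<C>"
    "\<And>i. i < 8 \<Longrightarrow> circle_at z r ` {\<theta> i<..<\<theta> (Suc i)} \<in>
      arcs_joining (\<phi> (circle_at z r (\<theta> i))) (\<phi> (circle_at z r (\<theta> (Suc i))))"
    using circle_cycle[OF E(1), of V1] unfolding E(2) finite_cyc(2) by metis
  define q where "q i = \<phi> (circle_at z r (\<theta> i))" for i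
  have q0: "q 0 = V1" and q8: "q 8 = V1" unfolding q_def \<theta>(4) by (simp_all add: \<theta>(5))
  have qc: "q i \<in> cyc" if "i < 8" for i using \<theta>(6) that by (auto simp: bij_betw_def q_def)
  have \<theta>_less: "\<theta> i < \<theta> j" if "i < j" "j \<le> 8" for i j
    using strict_mono_onD[OF \<theta>(3)] that by auto
  have pq: "pt (q i) = circle_at z r (\<theta> i)" if "i \<le> 8" for i
    using \<theta>(7)[OF that] by (simp add: q_def)
  have "[q 1, q 2, q 3, q 4, q 5, q 6, q 7] = [V2, V3, V4, V5, V6, V7, V8] \<or>
    [q 1, q 2, q 3, q 4, q 5, q 6, q 7] = [V8, V7, V6, V5, V4, V3, V2]"
  proof (rule cycle_walk[of q, OF q0])
    show "inj_on q {..<8}" using \<theta>(6) by (auto simp: bij_betw_def q_def inj_on_def)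
    fix i :: nat assume i: "i < 8"
    have "q (Suc i) \<in> cyc" using qc[of "Suc i"] q8 i by (cases "Suc i = 8") (auto simp: cyc_def)
    moreover have "count (edges M) (Upair (q i) (q (Suc i))) > 0"
      using arc_joining_imp_edge[OF _ _ \<theta>(8)[OF i]] by (simp add: q_def)
    ultimately show "q (Suc i) = nxt (q i) \<or> q (Suc i) = prv (q i)"
      using count_M_cyc[OF qc[OF i]] hub_not_cyc[OF qc[OF i]] by (auto split: if_splits)
  qed
  then show ?thesis
  proof
    assume "[q 1, q 2, q 3, q 4, q 5, q 6, q 7] = [V2, V3, V4, V5, V6, V7, V8]"
    then have q: "q 1 = V2" "q 2 = V3" "q 3 = V4" "q 4 = V5" "q 5 = V6" "q 6 = V7" "q 7 = V8"
      by simp_all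
    define a where "a v = \<theta> (case v of V1 \<Rightarrow> 0 | V2 \<Rightarrow> 1 | V3 \<Rightarrow> 2 | V4 \<Rightarrow> 3 | V5 \<Rightarrow> 4 | V6 \<Rightarrow> 5 | V7 \<Rightarrow> 6 | _ \<Rightarrow> 7)" for v
    have "pt v = circle_at z r (a v)" if "v \<in> cyc" for v
      using that q0 q pq[of 0] pq[of 1] pq[of 2] pq[of 3] pq[of 4] pq[of 5] pq[of 6] pq[of 7]
      by (auto simp: a_def cyc_def)
    then show ?thesis
      by (intro that[of r z 1 a]) (use \<theta>(1,2,4) \<theta>_less[of 7 8] in \<open>auto simp: a_def intro!: \<theta>_less\<close>)
  next
    assume "[q 1, q 2, q 3, q 4, q 5, q 6, q 7] = [V8, V7, V6, V5, V4, V3, V2]"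
    then have q: "q 1 = V8" "q 2 = V7" "q 3 = V6" "q 4 = V5" "q 5 = V4" "q 6 = V3" "q 7 = V2"
      by simp_all
    \<comment> \<open>\<open>V1\<close> takes the angle \<open>\<theta> 8 = \<theta> 0 + 2 * pi\<close>, so that it still comes first after negation.\<close>
    define a where "a v = - \<theta> (case v of V1 \<Rightarrow> 8 | V2 \<Rightarrow> 7 | V3 \<Rightarrow> 6 | V4 \<Rightarrow> 5 | V5 \<Rightarrow> 4 | V6 \<Rightarrow> 3 | V7 \<Rightarrow> 2 | _ \<Rightarrow> 1)" for v
    have "pt v = circle_at z r (- a v)" if "v \<in> cyc" for v
      using that q8 q pq[of 8] pq[of 1] pq[of 2] pq[of 3] pq[of 4] pq[of 5] pq[of 6] pq[of 7]
      by (auto simp: a_def cyc_def)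
    then show ?thesis
      by (intro that[of r z "-1" a]) (use \<theta>(1,2,4) \<theta>_less[of 0 1] \<theta>_less[of 7 8] in \<open>auto simp: a_def intro!: \<theta>_less\<close>)
  qed
qed

lemma no_representation: False
proof -
  obtain E C where E: "E \<in> \<C>" "verts_on E = cyc"
    and C: "\<And>v. v \<in> cyc \<Longrightarrow> C v \<in> \<C>" "\<And>v. v \<in> cyc \<Longrightarrow> verts_on (C v) = {hub v, v}"
    using cycle_circle by blast
  obtain z R \<sigma> a where R: "R > 0" "E = sphere z R" and \<sigma>: "\<sigma> = 1 \<or> \<sigma> = - 1"
    and a: "\<forall>v\<in>cyc. pt v = circle_at z R (\<sigma> * a v)"
    and ord: "a V1 < a V2" "a V2 < a V3" "a V3 < a V4" "a V4 < a V5" "a V5 < a V6" "a V6 < a V7" "a V7 < a V8"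
      "a V8 < a V1 + 2 * pi"
    using cyclic_angles[OF E] .
  define u where "u v = unit_at (\<sigma> * a v)" for v
  have pu: "pt v = z + R *\<^sub>R u v" if "v \<in> cyc" for v
    using a that by (simp add: circle_at_def u_def)
  have "\<exists>s. s \<noteq> R \<and> C v = sphere (z + (R - s) *\<^sub>R u v) \<bar>s\<bar>" if v: "v \<in> cyc" for v
  proof -
    obtain c r where cr: "C v = sphere c r" using circles[OF C(1)[OF v]] by (auto simp: is_circle_def)
    have "hub v \<in> verts_on (C v)" "hub v \<notin> verts_on E" using C(2)[OF v] E(2) hub_not_cyc[OF v] by simp_all
    then have ne: "C v \<noteq> E" by blast
    have "verts_on (C v) \<inter> verts_on E = {v}" using C(2)[OF v] E(2) hub_not_cyc[OF v] v by auto
    then have "sphere c r \<inter> sphere z R = {z + R *\<^sub>R u v}"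
      using common_points[OF C(1)[OF v] E(1) ne] pu[OF v] by (simp add: cr R(2))
    then obtain s where "s \<noteq> R" "c = z + (R - s) *\<^sub>R u v" "r = \<bar>s\<bar>"
      by (rule tangent_sphere_center[of R "u v" c r z, rotated 2])
        (use R ne cr in \<open>auto simp: u_def\<close>)
    then show ?thesis using cr by blast
  qed
  then have "\<forall>v\<in>cyc. \<exists>s. s \<noteq> R \<and> C v = sphere (z + (R - s) *\<^sub>R u v) \<bar>s\<bar>" by blast
  then obtain s where "\<forall>v\<in>cyc. s v \<noteq> R \<and> C v = sphere (z + (R - s v) *\<^sub>R u v) \<bar>s v\<bar>"
    unfolding bchoice_iff by blast
  then have s: "s v \<noteq> R" "C v = sphere (z + (R - s v) *\<^sub>R u v) \<bar>s v\<bar>" if "v \<in> cyc" for v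
    using that by blast+
  define k where "k v = s v / (R - s v)" for v
  define x where "x v = a v / 2" for v
  have meet: "(sin (x w - x v))\<^sup>2 \<le> k v * k w \<longleftrightarrow> hub v = hub w" if vw: "v \<in> cyc" "w \<in> cyc" "v \<noteq> w" for v w
  proof -
    have "v \<notin> verts_on (C w)" "v \<in> verts_on (C v)" using C(2) vw hub_not_cyc by auto
    then have "C v \<noteq> C w" by metis
    then have "C v \<inter> C w = pt ` ({hub v, v} \<inter> {hub w, w})"
      using common_points[OF C(1) C(1)] C(2) vw by metis
    also have "\<dots> \<noteq> {} \<longleftrightarrow> hub v = hub w" using vw hub_not_cyc by auto
    finally have "C v \<inter> C w \<noteq> {} \<longleftrightarrow> hub v = hub w" .
    moreover have "u v \<noteq> u w"
    proof
      assume "u v = u w"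
      then have "pt v = pt w" using pu vw by simp
      then show False using vw by simp
    qed
    then have "C v \<inter> C w \<noteq> {} \<longleftrightarrow> (norm (u v - u w))\<^sup>2 \<le> 4 * k v * k w"
      unfolding s(2)[OF vw(1)] s(2)[OF vw(2)] k_def
      by (intro tangent_spheres_meet_iff) (use s vw in \<open>auto simp: u_def\<close>)
    moreover have "(norm (u v - u w))\<^sup>2 = 4 * (sin (x w - x v))\<^sup>2"
    proof -
      have "(\<sigma> * a v - \<sigma> * a w) / 2 = x w - x v \<or> (\<sigma> * a v - \<sigma> * a w) / 2 = - (x w - x v)"
        using \<sigma> by (auto simp: x_def field_simps)
      then show ?thesis unfolding u_def norm_unit_at_diff by (metis power2_minus sin_minus)
    qed
    ultimately show ?thesis by auto
  qed
  then have le: "(sin (x w - x v))\<^sup>2 \<le> k v * k w"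
    if "v \<in> cyc" "w \<in> cyc" "v \<noteq> w" "hub v = hub w" for v w
    using that by blast
  have less: "k v * k w < (sin (x w - x v))\<^sup>2"
    if "v \<in> cyc" "w \<in> cyc" "v \<noteq> w" "hub v \<noteq> hub w" for v w
    using that meet[of v w] by linarith
  have "x V1 < x V2" "x V2 < x V3" "x V3 < x V4" "x V4 < x V5" "x V5 < x V6" "x V6 < x V7"
    "x V7 < x V8" "x V8 < x V1 + pi"
    using ord by (simp_all add: x_def)
  then show False
    by (rule tangent_circle_pattern_impossible) (rule le less; simp add: cyc_def)+
qed

end

theorem theorem2p4: "\<not> circle_representable M"
proof
  assume "circle_representable M"
  then obtain \<C> \<phi> \<psi> where
    "\<forall>C \<in> \<C>. is_circle C" "\<forall>p. finite (circles_through \<C> p) \<and> card (circles_through \<C> p) \<le> 2"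
    "bij_betw \<phi> (double_points \<C>) (verts M)" "bij_betw \<psi> (circle_arcs \<C>) (edge_copies M)"
    "\<forall>A \<in> circle_arcs \<C>. set_uprod (fst (\<psi> A)) = \<phi> ` arc_ends A"
    unfolding circle_representable_def circle_representation_def by blast
  moreover have "finite (verts M)" by (simp only: M_def multigraph.select_convs) simp
  ultimately interpret represented_M \<C> \<phi> \<psi>
    by unfold_locales blast+
  show False by (rule no_representation)
qed

end
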